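(* Let the data and notation be as in the context, where $(a_c,\psi)$ is one of the four corrections listed there, $g$, $\tau:I^+\to[0,1)$ and $\mu_G^c$ are defined there, and write $m:=\max I^+=\min\{\theta,\beta+\gamma\}$. Suppose that $$\mu_G^c(m)\le\mu_L^c(m)-\tan(\theta-m)\,\mu_D^c(m).\qquad(\ast)$$ Then the equation $$\mu_L^c(\varphi)-\tan(\theta-\varphi)\,\mu_D^c(\varphi)=\mu_G^c(\varphi)$$ admits a solution $\varphi\in I^+$ corresponding to a positive lift, i.e. with $C_L(\varphi-\gamma)>0$. Moreover, if $g$ is decreasing on $I^+$, $\max I^+=\theta$ and $\varphi_c<\theta$, where $\varphi_c\in I^+$ is the point with $\tau(\varphi_c)=a_c$, then $(\ast)$ is necessarily satisfied.
   Context: Fixed data: real numbers $\lambda>0$ (local speed ratio), $\sigma>0$ (solidity), $\gamma\in(-\frac\pi2,\frac\pi2)$ (twist), $\beta>0$ with $|\gamma|\le\beta$ and $\gamma\ne-\beta$ (so that $I^+$ below is nonempty); an integer $B\ge1$ (number of blades) and $s\in(0,1)$ (relative radial position $r/R$); a function $C_L:[-\beta,\beta]\to\mathbb{R}$ (lift coefficient) continuous on $[-\beta,\beta]$ and positive on $(0,\beta]$; a function $C_D:\mathbb{R}\to\mathbb{R}$ (drag coefficient) continuous and strictly positive. Notation: $\theta\in(0,\frac\pi2)$ is defined by $\tan\theta=1/\lambda$; $I:=[-\beta+\gamma,\beta+\gamma]\cap(-\frac\pi2+\theta,\frac\pi2+\theta)$ and $I^+:=I\cap(0,\theta]$, so $I^+=(0,\min\{\theta,\beta+\gamma\}]$.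 The tip loss factor is $F(\varphi):=\frac2\pi\arccos\Bigl(\exp\bigl(-\frac{(B/2)(1-s)}{s\,\sin\varphi}\bigr)\Bigr)$ for $\varphi\in(0,\frac\pi2)$. $\mu_L^c(\varphi):=\frac{\sigma}{4F(\varphi)}C_L(\varphi-\gamma)$, $\mu_D^c(\varphi):=\frac{\sigma}{4F(\varphi)}C_D(\varphi-\gamma)$. $(y)_+:=\max\{0,y\}$. The corrections $(a_c,\psi)$, with $x=(a-a_c)_+$, $a\in[0,1)$: (1) Glauert: $a_c=\frac13$, $\psi(x)=\frac x4\bigl(\frac{x^2}{a_c}+2x+a_c\bigr)$; (2) empirical Glauert: $a_c=\frac25$, $\psi((a-a_c)_+)\approx\bigl(\frac{1}{2(1-a_c)}-\frac{\nu}{4}(1-a)\bigr)(a-a_c)_+$ with the (rounded, empirical) constant $\nu=5.5563$, and in this case $F\equiv1$; (3) Buhl: $a_c=\frac25$, $\psi(x)=\frac{1}{2F(\varphi)}\bigl(\frac{x}{1-a_c}\bigr)^2$ (so $\psi$ also depends on $\varphi$ through $F$); (4) Wilson et al./Spera: $a_c=\frac13$, $\psi(x)=x^2$. Definition of $g$, $\tau$ and $\mu_G^c$: for $\varphi\in I^+$, $g(\varphi):=\cot\varphi\,\tan(\theta-\varphi)+\frac{\mu_D^c(\varphi)}{\sin\varphi}\bigl(1+\cot\varphi\,\tan(\theta-\varphi)\bigr)$; $\tau(\varphi)$ is the unique $a\in[0,1)$ such that $$\frac{a}{1-a}+\frac{\sin\theta\sin\varphi}{\cos(\theta-\varphi)}\,\frac{\psi((a-a_c)_+)}{(1-a)^2}=g(\varphi)$$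 (existence and uniqueness hold, and $\tau$ is continuous); and $$\mu_G^c(\varphi):=\sin\varphi\tan(\theta-\varphi)+\frac{\cos\theta\,\sin^2\varphi}{\cos(\theta-\varphi)}\,\frac{\psi((\tau(\varphi)-a_c)_+)}{(1-\tau(\varphi))^2}.$$
   Formalization: Added, as the claim fails without them: in the first part C_L(θ−γ)≠0 if θ≤γ, and for correction (2) μ_G^c(φ)≥0 at φ∈I⁺ with C_L(φ−γ)≤0; in the second part C_L(θ−γ)≥0 if θ<γ. Correction (2) is read as an equality with ν=5.5563. *)

theory Defs
  imports "HOL-Analysis.Analysis"
begin

datatype correction = Glauert | Empirical_Glauert | Buhl | Wilson_Spera

record bem =
  speed_ratio :: real             (* lambda *)
  solidity :: real                (* sigma *)
  twist :: real                   (* gamma *)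
  max_attack :: real              (* beta: the lift coefficient lives on [-beta, beta] *)
  blades :: nat                   (* B *)
  rel_radius :: real              (* s = r/R *)
  lift :: "real \<Rightarrow> real"          (* C_L; only its values on [-beta, beta] matter *)
  drag :: "real \<Rightarrow> real"          (* C_D *)
  corr :: correction

definition valid_bem :: "bem \<Rightarrow> bool" where
  "valid_bem d \<longleftrightarrow>
     0 < speed_ratio d \<and> 0 < solidity d \<and>
     - (pi / 2) < twist d \<and> twist d < pi / 2 \<and>
     0 < max_attack d \<and> \<bar>twist d\<bar> \<le> max_attack d \<and> twist d \<noteq> - max_attack d \<and>
     1 \<le> blades d \<and> 0 < rel_radius d \<and> rel_radius d < 1 \<and>
     continuous_on {- max_attack d..max_attack d} (lift d) \<and>
     (\<forall>x. 0 < x \<and> x \<le> max_attack d \<longrightarrow> 0 < lift d x) \<and>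
     continuous_on UNIV (drag d) \<and> (\<forall>x. 0 < drag d x)"

definition theta :: "bem \<Rightarrow> real" where
  "theta d = arctan (1 / speed_ratio d)"

definition I_set :: "bem \<Rightarrow> real set" where
  "I_set d = {- max_attack d + twist d..max_attack d + twist d}
     \<inter> {- (pi / 2) + theta d<..<pi / 2 + theta d}"

definition I_plus :: "bem \<Rightarrow> real set" where
  "I_plus d = I_set d \<inter> {0<..theta d}"

definition phi_max :: "bem \<Rightarrow> real" where
  "phi_max d = min (theta d) (max_attack d + twist d)"

definition tip_loss :: "bem \<Rightarrow> real \<Rightarrow> real" where
  "tip_loss d \<phi> =
     (if corr d = Empirical_Glauert then 1
      else 2 / pi * arccos (exp (- ((real (blades d) / 2) * (1 - rel_radius d)
                                    / (rel_radius d * sin \<phi>)))))"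

definition mu_L :: "bem \<Rightarrow> real \<Rightarrow> real" where
  "mu_L d \<phi> = solidity d / (4 * tip_loss d \<phi>) * lift d (\<phi> - twist d)"

definition mu_D :: "bem \<Rightarrow> real \<Rightarrow> real" where
  "mu_D d \<phi> = solidity d / (4 * tip_loss d \<phi>) * drag d (\<phi> - twist d)"

definition a_crit :: "bem \<Rightarrow> real" where
  "a_crit d = (case corr d of Glauert \<Rightarrow> 1/3 | Empirical_Glauert \<Rightarrow> 2/5
                            | Buhl \<Rightarrow> 2/5 | Wilson_Spera \<Rightarrow> 1/3)"

(* psi_plus d phi a is the correction term psi ((a - a_c)_+), as a function of a.
   With the rounded constant 5.5563 the empirical Glauert term is not quite nonnegative:
   it dips to about -2.24e-9 for 0 < a - a_c < 8.04e-5. *)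
definition psi_plus :: "bem \<Rightarrow> real \<Rightarrow> real \<Rightarrow> real" where
  "psi_plus d \<phi> a =
     (let ac = a_crit d; x = max 0 (a - ac) in
      case corr d of
        Glauert \<Rightarrow> x / 4 * (x\<^sup>2 / ac + 2 * x + ac)
      | Empirical_Glauert \<Rightarrow> (1 / (2 * (1 - ac)) - 5.5563 / 4 * (1 - a)) * x
      | Buhl \<Rightarrow> 1 / (2 * tip_loss d \<phi>) * (x / (1 - ac))\<^sup>2
      | Wilson_Spera \<Rightarrow> x\<^sup>2)"

definition g_fun :: "bem \<Rightarrow> real \<Rightarrow> real" where
  "g_fun d \<phi> = cot \<phi> * tan (theta d - \<phi>)
     + mu_D d \<phi> / sin \<phi> * (1 + cot \<phi> * tan (theta d - \<phi>))"

(* Only meaningful for phi in I_plus d, where there is exactly one such a. *)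
definition tau :: "bem \<Rightarrow> real \<Rightarrow> real" where
  "tau d \<phi> = (THE a. 0 \<le> a \<and> a < 1 \<and>
     a / (1 - a) + sin (theta d) * sin \<phi> / cos (theta d - \<phi>) * (psi_plus d \<phi> a / (1 - a)\<^sup>2)
       = g_fun d \<phi>)"

definition mu_G :: "bem \<Rightarrow> real \<Rightarrow> real" where
  "mu_G d \<phi> = sin \<phi> * tan (theta d - \<phi>)
     + cos (theta d) * (sin \<phi>)\<^sup>2 / cos (theta d - \<phi>)
         * (psi_plus d \<phi> (tau d \<phi>) / (1 - tau d \<phi>)\<^sup>2)"

(* The condition does not by itself give a solution with positive lift: for twist d = theta d,
   lift d x = x and small drag, it holds with equality and no angle in I_plus d has positive
   lift. Sign conditions on the lift at theta d are therefore needed for twist d >= theta d;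
   for twist d < theta d the lift at phi_max d is positive anyway. Nonnegativity of mu_G at
   the angles without positive lift has to be required only for Empirical_Glauert, because
   of the rounding in psi_plus. *)
definition endpoint_condition :: "bem \<Rightarrow> bool" where
  "endpoint_condition d \<longleftrightarrow>
     mu_G d (phi_max d) \<le> mu_L d (phi_max d) - tan (theta d - phi_max d) * mu_D d (phi_max d)"

lemma theta_bounds:
  assumes "valid_bem d"
  shows "0 < theta d" "theta d < pi / 2" "tan (theta d) = 1 / speed_ratio d"
  using assms arctan_ubound[of "1 / speed_ratio d"]
  by (simp_all add: valid_bem_def theta_def tan_arctan)

lemma I_plus_eq:
  assumes "valid_bem d"
  shows "I_plus d = {0<..phi_max d}"
proof -
  have "theta d < pi / 2 + theta d" by simp
  then show ?thesis
    using theta_bounds[OF assms] assms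
    unfolding valid_bem_def I_plus_def I_set_def phi_max_def by auto
qed

lemma phi_max_is_max:
  assumes "valid_bem d"
  shows "phi_max d \<in> I_plus d" "\<phi> \<in> I_plus d \<Longrightarrow> \<phi> \<le> phi_max d"
  using theta_bounds[OF assms] assms unfolding I_plus_eq[OF assms]
  by (auto simp: phi_max_def valid_bem_def)

end

theory Submission
  imports Defs
begin

text \<open>The left-hand side of the equation for \<open>\<tau>\<close> is strictly increasing in \<open>a\<close>, runs from \<open>0\<close> to infinity
  and is continuous in \<open>\<phi>\<close>, so \<open>\<tau>\<close> is well defined and continuous. Near \<open>\<phi> = 0\<close> the lift term is
  bounded while \<open>\<mu>\<^sub>G\<close> tends to infinity, and at a positive angle below \<open>\<theta>\<close> with non-positive lift the
  left-hand side of the balance equation is negative while \<open>\<mu>\<^sub>G \<ge> 0\<close>. The intermediate value theorem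
  therefore applies between the endpoint and either the last angle with non-positive lift or, if there
  is none, an angle close to \<open>0\<close>. If \<open>g\<close> is decreasing, then \<open>g \<theta> \<le> g \<phi>\<^sub>c = a\<^sub>c / (1 - a\<^sub>c)\<close> forces
  \<open>\<tau> \<theta> \<le> a\<^sub>c\<close>, so the correction vanishes at \<open>\<theta>\<close> and with it \<open>\<mu>\<^sub>G\<close>.\<close>

section \<open>Continuous dependence of roots of monotone equations\<close>

text \<open>By monotonicity the sign of \<open>g y - H y c\<close> decides on which side of
  \<open>c\<close> the root \<open>t y\<close> lies. This sign condition is open in
  \<open>y\<close>, because only the slice of \<open>H\<close> at the fixed level \<open>c\<close>
  enters.\<close>

lemma continuous_on_implicit_root:
  fixes H :: "'a::topological_space \<Rightarrow> real \<Rightarrow> real"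
  assumes contH: "\<And>a. \<lbrakk>l \<le> a; a < r\<rbrakk> \<Longrightarrow> continuous_on S (\<lambda>x. H x a)"
    and contg: "continuous_on S g"
    and mono: "\<And>x a b. \<lbrakk>x \<in> S; l \<le> a; a < b; b < r\<rbrakk> \<Longrightarrow> H x a < H x b"
    and root: "\<And>x. x \<in> S \<Longrightarrow> l \<le> t x \<and> t x < r \<and> H x (t x) = g x"
  shows "continuous_on S t"
  unfolding continuous_on_def
proof (intro ballI order_tendstoI)
  fix x c assume x: "x \<in> S" and c: "c < t x"
  show "\<forall>\<^sub>F y in at x within S. c < t y"
  \<comment> \<open>\<open>H\<close> is controlled only at levels in [l, r); a level below
    \<open>l\<close> lies below every root anyway.\<close>
  proof (cases "c < l")
    case True
    then have "\<forall>y\<in>S. c < t y" using root by force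
    then show ?thesis by (simp add: eventually_at_filter)
  next
    case False
    with c x root[of x] have "l \<le> c" "c < r" by auto
    then have "((\<lambda>y. g y - H y c) \<longlongrightarrow> g x - H x c) (at x within S)"
      using contH contg x by (auto intro!: tendsto_diff simp: continuous_on_def)
    moreover have "0 < g x - H x c"
      using mono[OF x \<open>l \<le> c\<close> c] root[OF x] by simp
    ultimately have "\<forall>\<^sub>F y in at x within S. 0 < g y - H y c"
      by (rule order_tendstoD)
    moreover have "\<forall>\<^sub>F y in at x within S. y \<in> S"
      by (simp add: eventually_at_filter)
    ultimately show ?thesis
    proof eventually_elim
      case (elim y)
      show ?case
        using mono[of y "t y" c] root[of y] elim \<open>c < r\<close> by (cases "t y" c rule: linorder_cases) auto
    qed
  qed
next
  fix x c assume x: "x \<in> S" and c: "t x < c"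
  show "\<forall>\<^sub>F y in at x within S. t y < c"
  proof (cases "r \<le> c")
    case True
    then have "\<forall>y\<in>S. t y < c" using root by force
    then show ?thesis by (simp add: eventually_at_filter)
  next
    case False
    with c x root[of x] have "l \<le> c" "c < r" by auto
    then have "((\<lambda>y. H y c - g y) \<longlongrightarrow> H x c - g x) (at x within S)"
      using contH contg x by (auto intro!: tendsto_diff simp: continuous_on_def)
    moreover have "0 < H x c - g x"
      using mono[OF x _ c \<open>c < r\<close>] root[OF x] by simp
    ultimately have "\<forall>\<^sub>F y in at x within S. 0 < H y c - g y"
      by (rule order_tendstoD)
    moreover have "\<forall>\<^sub>F y in at x within S. y \<in> S"
      by (simp add: eventually_at_filter)
    ultimately show ?thesis
    proof eventually_elim
      case (elim y)
      show ?case
        using mono[of y c "t y"] root[of y] elim \<open>l \<le> c\<close> by (cases "t y" c rule: linorder_cases) auto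
    qed
  qed
qed

section \<open>Bounds and monotonicity for the four corrections\<close>

lemma a_crit_bounds: "0 < a_crit d" "a_crit d < 1"
  by (cases "corr d"; simp add: a_crit_def)+

lemma psi_plus_eq_0: "a \<le> a_crit d \<Longrightarrow> psi_plus d \<phi> a = 0"
  by (cases "corr d") (auto simp: psi_plus_def Let_def)

lemma psi_plus_nonneg:
  assumes "corr d \<noteq> Empirical_Glauert" "0 < tip_loss d \<phi>"
  shows "0 \<le> psi_plus d \<phi> a"
  using assms a_crit_bounds[of d] by (cases "corr d") (auto simp: psi_plus_def Let_def)

lemma psi_plus_mono:
  assumes "corr d \<noteq> Empirical_Glauert" "0 < tip_loss d \<phi>" "a \<le> b"
  shows "psi_plus d \<phi> a \<le> psi_plus d \<phi> b"
proof -
  define x y where "x = max 0 (a - a_crit d)" and "y = max 0 (b - a_crit d)"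
  have xy: "0 \<le> x" "x \<le> y" using assms by (auto simp: x_def y_def)
  have sq: "x\<^sup>2 \<le> y\<^sup>2" using xy by (simp add: power_mono)
  show ?thesis
  proof (cases "corr d")
    case Glauert
    have "x / 4 * (x\<^sup>2 / a_crit d + 2 * x + a_crit d) \<le> y / 4 * (y\<^sup>2 / a_crit d + 2 * y + a_crit d)"
      using xy sq a_crit_bounds[of d] by (intro mult_mono add_mono divide_right_mono) auto
    then show ?thesis using Glauert by (simp add: psi_plus_def Let_def x_def y_def)
  next
    case Buhl
    have "1 / (2 * tip_loss d \<phi>) * (x / (1 - a_crit d))\<^sup>2 \<le> 1 / (2 * tip_loss d \<phi>) * (y / (1 - a_crit d))\<^sup>2"
      using xy assms a_crit_bounds[of d]
      by (intro mult_left_mono power_mono divide_right_mono) auto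
    then show ?thesis using Buhl by (simp add: psi_plus_def Let_def x_def y_def)
  next
    case Wilson_Spera
    then show ?thesis using sq by (simp add: psi_plus_def Let_def x_def y_def)
  qed (use assms in simp)
qed

text \<open>Divided by (1 - a)^2, this common bound shows that all four corrections grow at least
  quadratically in 1 / (1 - a) as a tends to 1. Up to \<open>a_crit\<close> the left-hand side is
  negative, since 1 - a is at least 3/5; beyond it each case is settled by completing a
  square.\<close>

lemma psi_plus_lower:
  assumes F: "0 < tip_loss d \<phi>" "tip_loss d \<phi> \<le> 1" and a: "0 \<le> a" "a < 1"
  shows "1 / 9 - (1 - a)\<^sup>2 \<le> psi_plus d \<phi> a"
proof (cases "a \<le> a_crit d")
  case True
  have "a_crit d \<le> 2 / 5" by (cases "corr d") (auto simp: a_crit_def)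
  with True have "(1 / 3)\<^sup>2 \<le> (1 - a)\<^sup>2" by (intro power_mono) auto
  then show ?thesis using psi_plus_eq_0[OF True] by (simp add: power2_eq_square)
next
  case False
  show ?thesis
  proof (cases "corr d")
    case Glauert
    define x where "x = a - 1/3"
    have x: "0 < x" using False Glauert by (simp add: a_crit_def x_def)
    have "psi_plus d \<phi> a = 3/4 * x ^ 3 + x\<^sup>2 / 2 + x / 12"
      using Glauert x by (simp add: psi_plus_def Let_def a_crit_def flip: x_def)
        (simp add: power2_eq_square power3_eq_cube algebra_simps)
    \<comment> \<open>The quadratic part of the correction is already enough: the two sides differ
      by 3/2 * ((x - 4/9)^2 + 2/81).\<close>
    moreover have "1 / 9 - (2/3 - x)\<^sup>2 \<le> x\<^sup>2 / 2"
      using zero_le_power2[of "x - 4/9"] by (simp add: power2_eq_square algebra_simps)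
    moreover have "1 - a = 2/3 - x" by (simp add: x_def)
    moreover have "0 < x ^ 3" using x by simp
    ultimately show ?thesis using x unfolding \<open>1 - a = 2/3 - x\<close> by linarith
  next
    case Empirical_Glauert
    then have x: "0 < a - 2/5" using False by (simp add: a_crit_def)
    \<comment> \<open>Rounding 5.5563 / 4 = 1.389075 up to 7/5 keeps the numbers short. In the
      square completed below, 13/20 is a rounded vertex; the linear remainder it leaves is positive
      for a < 1.\<close>
    have "(5/6 - 7/5 * (1 - a)) * (a - 2/5) \<le> (5/6 - 5.5563 / 4 * (1 - a)) * (a - 2/5)"
      using x a by (intro mult_right_mono diff_left_mono) auto
    also have "\<dots> = psi_plus d \<phi> a"
      using Empirical_Glauert x by (simp add: psi_plus_def Let_def a_crit_def)
    finally have "(5/6 - 7/5 * (1 - a)) * (a - 2/5) \<le> psi_plus d \<phi> a" .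
    moreover have "(5/6 - 7/5 * (1 - a)) * (a - 2/5) - (1/9 - (1 - a)\<^sup>2)
        = 12/5 * (a - 13/20)\<^sup>2 + (457/4500 - a/150)"
      by (simp add: field_simps power2_eq_square)
    moreover have "0 \<le> (a - 13/20)\<^sup>2" by simp
    ultimately show ?thesis using a by linarith
  next
    case Buhl
    then have x: "0 < a - 2/5" using False by (simp add: a_crit_def)
    have "1 / 2 \<le> 1 / (2 * tip_loss d \<phi>)" using F by (simp add: field_simps)
    then have "1 / 2 * ((a - 2/5) / (3/5))\<^sup>2 \<le> 1 / (2 * tip_loss d \<phi>) * ((a - 2/5) / (3/5))\<^sup>2"
      by (rule mult_right_mono) simp
    also have "\<dots> = psi_plus d \<phi> a"
      using Buhl x by (simp add: psi_plus_def Let_def a_crit_def)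
    finally have "1 / 2 * ((a - 2/5) / (3/5))\<^sup>2 \<le> psi_plus d \<phi> a" .
    moreover have "1 / 2 * ((a - 2/5) / (3/5))\<^sup>2 - (1/9 - (1 - a)\<^sup>2)
        = 43/18 * (a - 28/43)\<^sup>2 + 38/387"
      by (simp add: field_simps power2_eq_square)
    moreover have "0 \<le> (a - 28/43)\<^sup>2" by simp
    ultimately show ?thesis by linarith
  next
    case Wilson_Spera
    then have x: "0 < a - 1/3" using False by (simp add: a_crit_def)
    have "0 \<le> (a - 2/3)\<^sup>2" by simp
    then show ?thesis using Wilson_Spera x
      by (simp add: psi_plus_def Let_def a_crit_def power2_eq_square algebra_simps)
  qed
qed

text \<open>In the variable \<open>u = 1 / (1 - a)\<close> the empirical correction is a quadratic polynomial whose
  slope is at least \<open>-0.0002\<close> for \<open>u \<ge> 5/3\<close>; the rounding of the constant thus cannot destroy the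
  monotonicity of the thrust in \<open>a\<close>.\<close>

lemma psi_plus_increment:
  assumes F: "0 < tip_loss d \<phi>" and ab: "a < b" "b < 1"
  shows "- (b / (1 - b) - a / (1 - a)) / 2
    \<le> psi_plus d \<phi> b / (1 - b)\<^sup>2 - psi_plus d \<phi> a / (1 - a)\<^sup>2"
proof (cases "corr d = Empirical_Glauert")
  case False
  have "psi_plus d \<phi> a / (1 - a)\<^sup>2 \<le> psi_plus d \<phi> b / (1 - b)\<^sup>2"
    using psi_plus_mono[OF False F, of a b] psi_plus_nonneg[OF False F] ab
    by (intro frac_le power_mono) auto
  moreover have "a / (1 - a) \<le> b / (1 - b)" using ab by (simp add: field_simps)
  ultimately show ?thesis unfolding minus_diff_eq by (smt (verit) divide_nonpos_pos)
next
  case True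
  \<comment> \<open>With u = 1 / (1 - a), the quotient (a - 2/5) / (1 - a) is 3/5 * u - 1, and the
    first factor divided by 1 - a is 5/6 * u - 5.5563 / 4. The positive part becomes a clamp of u at
    5/3 = 1 / (1 - 2/5), which is a zero of \<open>q\<close>.\<close>
  define q :: "real \<Rightarrow> real" where "q u = (5/6 * u - 5.5563 / 4) * (3/5 * u - 1)" for u
  have eq: "psi_plus d \<phi> c / (1 - c)\<^sup>2 = q (max (5/3) (1 / (1 - c)))" if "c < 1" for c
  proof (cases "c \<le> 2/5")
    case c: True
    then have "1 / (1 - c) \<le> 5/3" using that by (simp add: field_simps)
    then show ?thesis using True c psi_plus_eq_0[of c d]
      by (simp add: a_crit_def q_def max_def)
  next
    case c: False
    then have "5/3 \<le> 1 / (1 - c)" using that by (simp add: field_simps)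
    moreover have "(5/6 - 5.5563 / 4 * v) * (3/5 - v) / v\<^sup>2 = q (1 / v)" if "v \<noteq> 0" for v :: real
      using that by (simp add: q_def field_simps power2_eq_square)
    from this[of "1 - c"] have "(5/6 - 5.5563 / 4 * (1 - c)) * (c - 2/5) / (1 - c)\<^sup>2 = q (1 / (1 - c))"
      using that by simp
    ultimately show ?thesis using True c
      by (simp add: psi_plus_def Let_def a_crit_def max_def)
  qed
  define U V where "U = max (5/3) (1 / (1 - a))" and "V = max (5/3) (1 / (1 - b))"
  have "1 / (1 - a) \<le> 1 / (1 - b)" using ab by (simp add: field_simps)
  then have UV: "5/3 \<le> U" "U \<le> V" "V - U \<le> 1 / (1 - b) - 1 / (1 - a)"
    by (auto simp: U_def V_def)
  have "1 / (1 - b) - 1 / (1 - a) = b / (1 - b) - a / (1 - a)"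
    using ab by (simp add: field_simps)
  moreover have "q V - q U = (V - U) * ((U + V) / 2 - (5/6 + 3/5 * (5.5563 / 4)))"
    by (simp add: q_def field_simps)
  moreover have "(V - U) * (- 1 / 2) \<le> (V - U) * ((U + V) / 2 - (5/6 + 3/5 * (5.5563 / 4)))"
  proof (rule mult_left_mono)
    \<comment> \<open>The right-hand side is the slope of a chord of \<open>q\<close>. As U + V is
      at least 10/3, it exceeds -0.01, so -1/2 leaves ample room.\<close>
    have "5.5563 / 4 \<le> (7/5 :: real)" by simp
    then show "- 1 / 2 \<le> (U + V) / 2 - (5/6 + 3/5 * (5.5563 / 4))"
      using UV(1,2) by argo
  qed (use UV in simp)
  ultimately have "- (b / (1 - b) - a / (1 - a)) / 2 \<le> q V - q U" using UV(3) by argo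
  then show ?thesis using eq[of a] eq[of b] ab by (simp add: U_def V_def)
qed

section \<open>The equation for \<open>tau\<close> as a function of the induction factor\<close>

definition thrust_weight :: "bem \<Rightarrow> real \<Rightarrow> real" where
  "thrust_weight d \<phi> = sin (theta d) * sin \<phi> / cos (theta d - \<phi>)"

text \<open>The left-hand side of the equation whose root is \<open>tau\<close>; the right-hand side
  is \<open>g_fun\<close>.\<close>

definition thrust :: "bem \<Rightarrow> real \<Rightarrow> real \<Rightarrow> real" where
  "thrust d \<phi> a = a / (1 - a) + thrust_weight d \<phi> * (psi_plus d \<phi> a / (1 - a)\<^sup>2)"

lemma thrust_le_a_crit: "a \<le> a_crit d \<Longrightarrow> thrust d \<phi> a = a / (1 - a)"
  by (simp add: thrust_def psi_plus_eq_0)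

lemma continuous_on_psi_plus: "continuous_on A (psi_plus d \<phi>)"
proof -
  have "a_crit d \<noteq> 0" "1 - a_crit d \<noteq> 0" using a_crit_bounds[of d] by auto
  then show ?thesis unfolding psi_plus_def Let_def divide_inverse
    by (cases "corr d") (auto intro!: continuous_intros)
qed

context
  fixes d :: bem
  assumes valid: "valid_bem d"
begin

section \<open>Signs, bounds and continuity of the coefficients\<close>

lemma sin_theta_pos: "0 < sin (theta d)" and cos_theta_pos: "0 < cos (theta d)"
  using theta_bounds[OF valid] by (auto intro: sin_gt_zero cos_gt_zero)

lemma I_plus_trig:
  assumes "\<phi> \<in> I_plus d"
  shows "0 < sin \<phi>" "0 < cos \<phi>" "0 < cos (theta d - \<phi>)" "0 \<le> tan (theta d - \<phi>)"
    "\<phi> < theta d \<Longrightarrow> 0 < tan (theta d - \<phi>)"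
proof -
  have p: "0 < \<phi>" "\<phi> \<le> theta d" using assms by (auto simp: I_plus_def)
  note th = theta_bounds[OF valid]
  show "0 < sin \<phi>" using p th by (intro sin_gt_zero) auto
  show "0 < cos \<phi>" using p th by (intro cos_gt_zero) auto
  show "0 < cos (theta d - \<phi>)" using p th by (intro cos_gt_zero_pi) auto
  show less: "0 < tan (theta d - \<phi>)" if "\<phi> < theta d"
    using p th that by (intro tan_gt_zero) auto
  show "0 \<le> tan (theta d - \<phi>)" using less p by (cases "\<phi> = theta d") auto
qed

lemma continuous_on_tan_theta: "continuous_on (I_plus d) (\<lambda>\<phi>. tan (theta d - \<phi>))"
proof -
  have "cos (theta d - \<phi>) \<noteq> 0" if "\<phi> \<in> I_plus d" for \<phi>
    using I_plus_trig(3)[OF that] by simp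
  then show ?thesis by (intro continuous_intros ballI) blast+
qed

lemma attack_range:
  assumes "\<phi> \<in> I_plus d"
  shows "\<phi> - twist d \<in> {- max_attack d..max_attack d}"
  using assms valid by (auto simp: I_plus_def I_set_def)

lemma tip_loss_bounds:
  obtains F\<^sub>0 where "0 < F\<^sub>0" "\<And>\<phi>. \<phi> \<in> I_plus d \<Longrightarrow> F\<^sub>0 \<le> tip_loss d \<phi> \<and> tip_loss d \<phi> \<le> 1"
proof (cases "corr d = Empirical_Glauert")
  case True
  then show ?thesis using that[of 1] by (simp add: tip_loss_def)
next
  case False
  define K where "K = real (blades d) / 2 * (1 - rel_radius d) / rel_radius d"
  have K: "0 < K" using valid by (auto simp: valid_bem_def K_def)
  show ?thesis
  proof (rule that[of "2 / pi * arccos (exp (- K))"])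
    have "- 1 \<le> exp (- K)" by (rule order_trans[of _ 0]) auto
    then have "0 < arccos (exp (- K))"
      using arccos_less_arccos[of "exp (- K)" 1] K by simp
    then show "0 < 2 / pi * arccos (exp (- K))" by simp
    fix \<phi> assume "\<phi> \<in> I_plus d"
    note s = I_plus_trig(1)[OF this]
    have F: "tip_loss d \<phi> = 2 / pi * arccos (exp (- (K / sin \<phi>)))"
      using False by (simp add: tip_loss_def K_def mult.assoc)
    have "K \<le> K / sin \<phi>" using K s sin_le_one[of \<phi>] by (simp add: pos_le_divide_eq mult_left_le)
    then have "exp (- (K / sin \<phi>)) \<le> exp (- K)" by simp
    then have "arccos (exp (- K)) \<le> arccos (exp (- (K / sin \<phi>)))"
      using K less_le_trans[of "-1" 0 "exp (- (K / sin \<phi>))"] by (intro arccos_le_arccos) auto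
    moreover have "arccos (exp (- (K / sin \<phi>))) \<le> pi / 2"
      using K s by (intro arccos_le_pi2) auto
    ultimately show "2 / pi * arccos (exp (- K)) \<le> tip_loss d \<phi> \<and> tip_loss d \<phi> \<le> 1"
      unfolding F using pi_gt_zero by (simp add: field_simps)
  qed
qed

lemma tip_loss_pos: "0 < tip_loss d \<phi>"
  and tip_loss_le_1: "tip_loss d \<phi> \<le> 1" if "\<phi> \<in> I_plus d"
proof -
  obtain F\<^sub>0 where "0 < F\<^sub>0" "F\<^sub>0 \<le> tip_loss d \<phi>" "tip_loss d \<phi> \<le> 1"
    by (rule tip_loss_bounds) (use \<open>\<phi> \<in> I_plus d\<close> in blast)
  then show "0 < tip_loss d \<phi>" "tip_loss d \<phi> \<le> 1" by auto
qed

lemma continuous_on_tip_loss: "continuous_on (I_plus d) (tip_loss d)"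
proof (cases "corr d = Empirical_Glauert")
  case True
  then show ?thesis by (simp add: tip_loss_def)
next
  case False
  define e where "e \<phi> = exp (- (real (blades d) / 2 * (1 - rel_radius d) / (rel_radius d * sin \<phi>)))" for \<phi>
  have "rel_radius d * sin \<phi> \<noteq> 0" if "\<phi> \<in> I_plus d" for \<phi>
    using I_plus_trig(1)[OF that] valid by (simp add: valid_bem_def)
  then have "continuous_on (I_plus d) e"
    unfolding e_def by (intro continuous_intros) auto
  moreover have "- 1 \<le> e \<phi> \<and> e \<phi> \<le> 1" if "\<phi> \<in> I_plus d" for \<phi>
    using I_plus_trig(1)[OF that] valid order_trans[of "-1" 0 "e \<phi>"]
    by (simp add: valid_bem_def e_def)
  ultimately have "continuous_on (I_plus d) (\<lambda>\<phi>. 2 / pi * arccos (e \<phi>))"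
    by (intro continuous_intros) auto
  then show ?thesis using False by (simp add: tip_loss_def e_def)
qed

lemma continuous_on_lift: "continuous_on (I_plus d) (\<lambda>\<phi>. lift d (\<phi> - twist d))"
proof (rule continuous_on_compose2[of "{- max_attack d..max_attack d}" "lift d"])
  show "(\<lambda>\<phi>. \<phi> - twist d) ` I_plus d \<subseteq> {- max_attack d..max_attack d}"
    using attack_range by blast
qed (use valid in \<open>auto simp: valid_bem_def intro!: continuous_intros\<close>)

lemma continuous_on_mu_L: "continuous_on (I_plus d) (mu_L d)"
  using less_imp_neq[OF tip_loss_pos] unfolding mu_L_def
  by (intro continuous_intros continuous_on_tip_loss continuous_on_lift) auto

lemma continuous_on_mu_D: "continuous_on (I_plus d) (mu_D d)"
proof -
  have "continuous_on (I_plus d) (\<lambda>\<phi>. drag d (\<phi> - twist d))"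
    by (rule continuous_on_compose2[of UNIV "drag d"])
       (use valid in \<open>auto simp: valid_bem_def intro!: continuous_intros\<close>)
  from this less_imp_neq[OF tip_loss_pos] show ?thesis unfolding mu_D_def
    by (intro continuous_on_mult continuous_on_divide continuous_on_const continuous_on_tip_loss) auto
qed

lemma mu_D_pos: "\<phi> \<in> I_plus d \<Longrightarrow> 0 < mu_D d \<phi>"
  using tip_loss_pos[of \<phi>] valid by (simp add: mu_D_def valid_bem_def)

lemma continuous_on_g_fun: "continuous_on (I_plus d) (g_fun d)"
  using less_imp_neq[OF I_plus_trig(1)] unfolding g_fun_def cot_def
  by (intro continuous_intros continuous_on_mu_D continuous_on_tan_theta) auto

text \<open>The addition theorem turns 1 + cot \<phi> * tan (\<theta> - \<phi>) into sin \<theta> /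
  (sin \<phi> * cos (\<theta> - \<phi>)). It remains to use cos \<le> 1 and to drop the nonnegative
  first summand of \<open>g_fun\<close>.\<close>

lemma g_fun_lower:
  assumes "\<phi> \<in> I_plus d"
  shows "mu_D d \<phi> * sin (theta d) / (sin \<phi>)\<^sup>2 \<le> g_fun d \<phi>"
proof -
  note t = I_plus_trig[OF assms]
  have "sin (theta d) = sin \<phi> * cos (theta d - \<phi>) + cos \<phi> * sin (theta d - \<phi>)"
    using sin_add[of \<phi> "theta d - \<phi>"] by simp
  then have "1 + cot \<phi> * tan (theta d - \<phi>) = sin (theta d) / sin \<phi> / cos (theta d - \<phi>)"
    using t by (simp add: cot_def tan_def field_simps)
  moreover have "sin (theta d) / sin \<phi> \<le> sin (theta d) / sin \<phi> / cos (theta d - \<phi>)"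
    using t sin_theta_pos by (simp add: pos_le_divide_eq mult_left_le)
  ultimately have "mu_D d \<phi> / sin \<phi> * (sin (theta d) / sin \<phi>)
      \<le> mu_D d \<phi> / sin \<phi> * (1 + cot \<phi> * tan (theta d - \<phi>))"
    using t mu_D_pos[OF assms] by (intro mult_left_mono) auto
  moreover have "0 \<le> cot \<phi> * tan (theta d - \<phi>)" using t by (simp add: cot_def)
  ultimately show ?thesis by (simp add: g_fun_def power2_eq_square)
qed

lemma g_fun_pos:
  assumes "\<phi> \<in> I_plus d"
  shows "0 < g_fun d \<phi>"
  using g_fun_lower[OF assms] mu_D_pos[OF assms] I_plus_trig[OF assms] sin_theta_pos
  by (smt (verit) divide_pos_pos mult_pos_pos zero_less_power)

section \<open>Existence, uniqueness and continuity of \<open>tau\<close>\<close>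

text \<open>The upper bound holds because cos (\<theta> - \<phi>) exceeds sin \<theta> * sin \<phi>
  by the positive product cos \<theta> * cos \<phi>.\<close>

lemma thrust_weight_bounds:
  assumes "\<phi> \<in> I_plus d"
  shows "sin (theta d) * sin \<phi> \<le> thrust_weight d \<phi>" "0 < thrust_weight d \<phi>" "thrust_weight d \<phi> < 1"
proof -
  note t = I_plus_trig[OF assms]
  show "sin (theta d) * sin \<phi> \<le> thrust_weight d \<phi>"
    using t sin_theta_pos by (simp add: thrust_weight_def pos_le_divide_eq mult_left_le)
  show "0 < thrust_weight d \<phi>" using t sin_theta_pos by (simp add: thrust_weight_def)
  show "thrust_weight d \<phi> < 1"
    using t cos_theta_pos by (simp add: thrust_weight_def cos_diff)
qed

lemma continuous_on_thrust_weight: "continuous_on (I_plus d) (thrust_weight d)"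
proof -
  have "cos (theta d - \<phi>) \<noteq> 0" if "\<phi> \<in> I_plus d" for \<phi>
    using I_plus_trig(3)[OF that] by simp
  then show ?thesis unfolding thrust_weight_def by (intro continuous_intros ballI) blast+
qed

text \<open>The correction quotient can fall by at most half the increase of a / (1 - a), and it
  enters with a weight below 1, so the first summand wins.\<close>

lemma thrust_strict_mono:
  assumes \<phi>: "\<phi> \<in> I_plus d" and ab: "a < b" "b < 1"
  shows "thrust d \<phi> a < thrust d \<phi> b"
proof -
  define D where "D = b / (1 - b) - a / (1 - a)"
  have "a / (1 - a) < b / (1 - b)" using ab by (simp add: field_simps)
  then have "0 < D" by (simp add: D_def)
  have k: "0 < thrust_weight d \<phi>" "thrust_weight d \<phi> < 1"
    using thrust_weight_bounds[OF \<phi>] by auto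
  let ?Q = "\<lambda>c. psi_plus d \<phi> c / (1 - c)\<^sup>2"
  have "thrust_weight d \<phi> * (- D / 2) \<le> thrust_weight d \<phi> * (?Q b - ?Q a)"
    using psi_plus_increment[OF tip_loss_pos[OF \<phi>] ab] k unfolding D_def by (intro mult_left_mono) auto
  moreover have "thrust_weight d \<phi> * D < 1 * D" using k \<open>0 < D\<close> by (intro mult_strict_right_mono)
  ultimately have "- D < thrust_weight d \<phi> * (?Q b - ?Q a)" using \<open>0 < D\<close> by linarith
  then show ?thesis unfolding thrust_def D_def right_diff_distrib by linarith
qed

lemma correction_lower:
  assumes \<phi>: "\<phi> \<in> I_plus d" and a: "0 \<le> a" "a < 1"
  shows "(1 / (1 - a))\<^sup>2 / 9 - 1 \<le> psi_plus d \<phi> a / (1 - a)\<^sup>2"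
proof -
  have "(1 / 9 - (1 - a)\<^sup>2) / (1 - a)\<^sup>2 \<le> psi_plus d \<phi> a / (1 - a)\<^sup>2"
    using psi_plus_lower[OF tip_loss_pos[OF \<phi>] tip_loss_le_1[OF \<phi>] a] by (intro divide_right_mono) auto
  moreover have "(1 / 9 - (1 - a)\<^sup>2) / (1 - a)\<^sup>2 = (1 / (1 - a))\<^sup>2 / 9 - 1"
    using a by (simp add: field_simps)
  ultimately show ?thesis by simp
qed

lemma thrust_root_exists:
  assumes \<phi>: "\<phi> \<in> I_plus d"
  shows "\<exists>a. 0 \<le> a \<and> a < 1 \<and> thrust d \<phi> a = g_fun d \<phi>"
proof -
  \<comment> \<open>Chosen so that b / (1 - b) = g + 1: the spare 1 absorbs a correction quotient
    that is at least -1 and has weight below 1.\<close>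
  define b where "b = 1 - 1 / (g_fun d \<phi> + 2)"
  have g: "0 < g_fun d \<phi>" by (rule g_fun_pos[OF \<phi>])
  have b: "0 \<le> b" "b < 1" "1 / (1 - b) = g_fun d \<phi> + 2" using g by (auto simp: b_def)
  note k = thrust_weight_bounds[OF \<phi>]
  have "- 1 \<le> psi_plus d \<phi> b / (1 - b)\<^sup>2"
    using correction_lower[OF \<phi> b(1,2)] zero_le_power2[of "1 / (1 - b)"] by linarith
  then have "thrust_weight d \<phi> * (- 1) \<le> thrust_weight d \<phi> * (psi_plus d \<phi> b / (1 - b)\<^sup>2)"
    using k by (intro mult_left_mono) auto
  moreover have "b / (1 - b) = 1 / (1 - b) - 1" using b by (simp add: field_simps)
  ultimately have "g_fun d \<phi> \<le> thrust d \<phi> b" using b k by (simp add: thrust_def)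
  moreover have "thrust d \<phi> 0 \<le> g_fun d \<phi>"
    using g a_crit_bounds[of d] by (simp add: thrust_le_a_crit)
  moreover have "continuous_on {0..b} (thrust d \<phi>)"
    unfolding thrust_def using b by (intro continuous_intros continuous_on_psi_plus) auto
  ultimately obtain a where "0 \<le> a" "a \<le> b" "thrust d \<phi> a = g_fun d \<phi>"
    using IVT'[of "thrust d \<phi>" 0 "g_fun d \<phi>" b] b by blast
  then show ?thesis using b by auto
qed

lemma tau_root:
  assumes \<phi>: "\<phi> \<in> I_plus d"
  shows "0 \<le> tau d \<phi> \<and> tau d \<phi> < 1 \<and> thrust d \<phi> (tau d \<phi>) = g_fun d \<phi>"
proof -
  have "a = b" if "a < 1" "b < 1" "thrust d \<phi> a = thrust d \<phi> b" for a b
    using that thrust_strict_mono[OF \<phi>, of a b] thrust_strict_mono[OF \<phi>, of b a]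
    by (cases a b rule: linorder_cases) auto
  then have "\<exists>!a. 0 \<le> a \<and> a < 1 \<and> thrust d \<phi> a = g_fun d \<phi>"
    using thrust_root_exists[OF \<phi>] by (intro ex_ex1I) auto
  then show ?thesis unfolding tau_def thrust_def thrust_weight_def by (rule theI')
qed

lemma continuous_on_tau: "continuous_on (I_plus d) (tau d)"
proof (rule continuous_on_implicit_root[where l = 0 and r = 1 and H = "thrust d" and g = "g_fun d"])
  fix a :: real assume "0 \<le> a" "a < 1"
  moreover have "continuous_on (I_plus d) (\<lambda>\<phi>. psi_plus d \<phi> a)"
    using less_imp_neq[OF tip_loss_pos] unfolding psi_plus_def Let_def
    by (cases "corr d") (auto intro!: continuous_intros continuous_on_tip_loss)
  ultimately show "continuous_on (I_plus d) (\<lambda>\<phi>. thrust d \<phi> a)"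
    unfolding thrust_def by (intro continuous_intros continuous_on_thrust_weight) auto
qed (use continuous_on_g_fun thrust_strict_mono tau_root in auto)

section \<open>Continuity of \<open>mu_G\<close> and its growth near 0\<close>

text \<open>The equation for \<open>tau\<close> eliminates the correction, so continuity of
  \<open>mu_G\<close> reduces to that of \<open>g_fun\<close> and \<open>tau\<close>.\<close>

lemma mu_G_eq:
  assumes \<phi>: "\<phi> \<in> I_plus d"
  shows "mu_G d \<phi> = sin \<phi> * tan (theta d - \<phi>)
    + cos (theta d) / sin (theta d) * sin \<phi> * (g_fun d \<phi> - tau d \<phi> / (1 - tau d \<phi>))"
proof -
  have "thrust_weight d \<phi> * (psi_plus d \<phi> (tau d \<phi>) / (1 - tau d \<phi>)\<^sup>2)
      = g_fun d \<phi> - tau d \<phi> / (1 - tau d \<phi>)"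
    using tau_root[OF \<phi>] by (simp add: thrust_def)
  moreover have "cos (theta d) * (sin \<phi>)\<^sup>2 / cos (theta d - \<phi>)
      = cos (theta d) / sin (theta d) * sin \<phi> * thrust_weight d \<phi>"
    using sin_theta_pos by (simp add: thrust_weight_def power2_eq_square)
  ultimately show ?thesis by (simp only: mu_G_def mult.assoc)
qed

lemma continuous_on_mu_G: "continuous_on (I_plus d) (mu_G d)"
proof -
  have "1 - tau d \<phi> \<noteq> 0" if "\<phi> \<in> I_plus d" for \<phi>
    using tau_root[OF that] by simp
  then have "continuous_on (I_plus d) (\<lambda>\<phi>. sin \<phi> * tan (theta d - \<phi>)
    + cos (theta d) / sin (theta d) * sin \<phi> * (g_fun d \<phi> - tau d \<phi> / (1 - tau d \<phi>)))"
    using sin_theta_pos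
    by (intro continuous_intros continuous_on_g_fun continuous_on_tau continuous_on_tan_theta) auto
  then show ?thesis by (subst continuous_on_cong[OF refl mu_G_eq])
qed

lemma mu_G_nonneg:
  assumes "corr d \<noteq> Empirical_Glauert" and \<phi>: "\<phi> \<in> I_plus d"
  shows "0 \<le> mu_G d \<phi>"
  using psi_plus_nonneg[OF assms(1) tip_loss_pos[OF \<phi>]] I_plus_trig[OF \<phi>] cos_theta_pos
  unfolding mu_G_def by (intro add_nonneg_nonneg mult_nonneg_nonneg divide_nonneg_nonneg) auto

text \<open>Since \<open>g\<close> grows like \<open>1 / (sin \<phi>)\<^sup>2\<close> at \<open>0\<close> while the correction is quadratic in
  \<open>u = 1 / (1 - \<tau>)\<close> with a weight \<open>k\<close> of order \<open>sin \<phi>\<close>, one has \<open>u = O((sin \<phi>) powr (- 3/2))\<close>, so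
  the correction takes up almost all of \<open>g\<close>. The estimate \<open>u \<le> k u\<^sup>2 / 9 + 9 / (4 k)\<close> makes
  this quantitative.\<close>

lemma mu_G_lower:
  assumes \<phi>: "\<phi> \<in> I_plus d"
  shows "cos (theta d) / (2 * sin (theta d)) * (sin \<phi> * g_fun d \<phi> - 9 / (4 * sin (theta d)) - 1)
    \<le> mu_G d \<phi>"
proof -
  define a where "a = tau d \<phi>"
  define u where "u = 1 / (1 - a)"
  define k where "k = thrust_weight d \<phi>"
  define Q where "Q = psi_plus d \<phi> a / (1 - a)\<^sup>2"
  define s where "s = sin \<phi>"
  note t = I_plus_trig[OF \<phi>]
  have s: "0 < s" "s \<le> 1" using t by (auto simp: s_def)
  have k: "sin (theta d) * s \<le> k" "0 < k" "k < 1"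
    using thrust_weight_bounds[OF \<phi>] by (auto simp: k_def s_def)
  have a: "0 \<le> a" "a < 1" "a / (1 - a) + k * Q = g_fun d \<phi>"
    using tau_root[OF \<phi>] by (auto simp: a_def k_def Q_def thrust_def)
  have "a / (1 - a) = u - 1" using a by (simp add: u_def field_simps)
  then have root: "k * Q = g_fun d \<phi> - (u - 1)" using a by simp
  have "k * (u\<^sup>2 / 9 - 1) \<le> k * Q"
    using correction_lower[OF \<phi> a(1,2)] k by (intro mult_left_mono) (auto simp: u_def Q_def)
  moreover have "u \<le> k * (u\<^sup>2 / 9) + 9 / (4 * k)"
  proof -
    have "0 \<le> (2 * k * u - 9)\<^sup>2 / (36 * k)" using k by simp
    also have "\<dots> = k * (u\<^sup>2 / 9) + 9 / (4 * k) - u"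
      using k by (simp add: field_simps power2_eq_square)
    finally show ?thesis by simp
  qed
  ultimately have "u - 9 / (4 * k) - k \<le> k * Q" by (simp add: algebra_simps)
  \<comment> \<open>Eliminating \<open>u\<close> through \<open>root\<close> puts
    \<open>k * Q\<close> on both sides, whence the factor 2.\<close>
  then have "g_fun d \<phi> - 9 / (4 * k) - 1 \<le> 2 * (k * Q)" using root k by simp
  then have "s * (g_fun d \<phi> - 9 / (4 * k) - 1) \<le> s * (2 * (k * Q))"
    using s by (intro mult_left_mono) auto
  \<comment> \<open>The factor \<open>s\<close> makes the singular term bounded, because
    \<open>k\<close> is at least \<open>sin (theta d) * s\<close>.\<close>
  moreover have "s * (9 / (4 * k)) \<le> 9 / (4 * sin (theta d))"
    using k sin_theta_pos s by (simp add: field_simps)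
  ultimately have "s * g_fun d \<phi> - 9 / (4 * sin (theta d)) - 1 \<le> 2 * s * (k * Q)"
    using s by (simp add: algebra_simps)
  then have "cos (theta d) / (2 * sin (theta d)) * (s * g_fun d \<phi> - 9 / (4 * sin (theta d)) - 1)
      \<le> cos (theta d) / (2 * sin (theta d)) * (2 * s * (k * Q))"
    using sin_theta_pos cos_theta_pos by (intro mult_left_mono) auto
  also have "\<dots> = cos (theta d) / sin (theta d) * s * (k * Q)" by simp
  also have "\<dots> \<le> s * tan (theta d - \<phi>) + cos (theta d) / sin (theta d) * s * (k * Q)"
    using s t by simp
  also have "\<dots> = mu_G d \<phi>"
    using mu_G_eq[OF \<phi>] a(3) by (simp add: a_def s_def)
  finally show ?thesis by (simp add: s_def)
qed

text \<open>On the compact range of attack angles the lift is bounded above and the drag is bounded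
  below by a positive constant. Hence \<open>mu_L\<close> stays bounded while sin \<phi> * g, and
  with it the lower bound for \<open>mu_G\<close>, tends to infinity.\<close>

lemma balance_negative_near_0:
  obtains \<phi> where "\<phi> \<in> I_plus d" "mu_L d \<phi> - tan (theta d - \<phi>) * mu_D d \<phi> \<le> mu_G d \<phi>"
proof -
  obtain F\<^sub>0 where F\<^sub>0: "0 < F\<^sub>0" "\<And>\<phi>. \<phi> \<in> I_plus d \<Longrightarrow> F\<^sub>0 \<le> tip_loss d \<phi> \<and> tip_loss d \<phi> \<le> 1"
    using tip_loss_bounds by blast
  define J where "J = {- max_attack d..max_attack d}"
  have J: "compact J" "J \<noteq> {}" using valid by (auto simp: J_def valid_bem_def)
  have sig: "0 < solidity d" using valid by (simp add: valid_bem_def)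
  obtain L where L: "\<And>x. x \<in> J \<Longrightarrow> lift d x \<le> L" "0 \<le> L"
  proof -
    have "continuous_on J (lift d)" using valid by (simp add: J_def valid_bem_def)
    from continuous_attains_sup[OF J this] obtain z where "\<forall>y\<in>J. lift d y \<le> lift d z" by blast
    then show ?thesis using that[of "max 0 (lift d z)"] by force
  qed
  obtain D where D: "\<And>x. x \<in> J \<Longrightarrow> D \<le> drag d x" "0 < D"
  proof -
    have "continuous_on J (drag d)"
      using valid continuous_on_subset by (auto simp: valid_bem_def)
    from continuous_attains_inf[OF J this] obtain z where "\<forall>y\<in>J. drag d z \<le> drag d y" by blast
    then show ?thesis using that[of "drag d z"] valid by (auto simp: valid_bem_def)
  qed
  \<comment> \<open>\<open>M\<close> bounds \<open>mu_L\<close>, and A / (sin \<phi>)^2 bounds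
    \<open>g_fun\<close> from below (tip loss at most 1). \<open>N\<close> is the size of sin \<phi>
    * g at which \<open>mu_G_lower\<close> yields \<open>M\<close>.\<close>
  define M where "M = solidity d / (4 * F\<^sub>0) * L"
  define A where "A = solidity d / 4 * D * sin (theta d)"
  define N where "N = 2 * sin (theta d) / cos (theta d) * M + 9 / (4 * sin (theta d)) + 1"
  have M: "0 \<le> M" using sig F\<^sub>0 L by (simp add: M_def)
  have A: "0 < A" using sig D sin_theta_pos by (simp add: A_def)
  have N: "0 < N" unfolding N_def using sin_theta_pos cos_theta_pos M
    by (intro add_nonneg_pos add_nonneg_nonneg mult_nonneg_nonneg divide_nonneg_nonneg) auto
  \<comment> \<open>From sin \<phi> \<le> \<phi> \<le> A / N it follows that A / sin \<phi> reaches
    \<open>N\<close>.\<close>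
  define \<phi> where "\<phi> = min (phi_max d) (A / N)"
  have "0 < phi_max d" using phi_max_is_max(1)[OF valid] I_plus_eq[OF valid] by auto
  then have \<phi>: "\<phi> \<in> I_plus d" using A N by (simp add: I_plus_eq[OF valid] \<phi>_def)
  then have F: "F\<^sub>0 \<le> tip_loss d \<phi>" "tip_loss d \<phi> \<le> 1" "0 < tip_loss d \<phi>" using F\<^sub>0 tip_loss_pos by auto
  note t = I_plus_trig[OF \<phi>]
  have att: "\<phi> - twist d \<in> J" using attack_range[OF \<phi>] by (simp add: J_def)
  have "mu_L d \<phi> \<le> solidity d / (4 * tip_loss d \<phi>) * L"
    using L(1)[OF att] F sig unfolding mu_L_def by (intro mult_left_mono) auto
  also have "\<dots> \<le> M" unfolding M_def
    using F F\<^sub>0(1) sig L by (intro mult_right_mono divide_left_mono) auto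
  finally have muL: "mu_L d \<phi> \<le> M" .
  have "solidity d / 4 * D \<le> mu_D d \<phi>" unfolding mu_D_def
    using D(1)[OF att] D(2) F sig by (intro mult_mono divide_left_mono) auto
  then have "A \<le> mu_D d \<phi> * sin (theta d)"
    unfolding A_def using sin_theta_pos by (intro mult_right_mono) auto
  then have "A / (sin \<phi>)\<^sup>2 \<le> g_fun d \<phi>"
    using g_fun_lower[OF \<phi>] by (meson divide_right_mono order_trans zero_le_power2)
  then have g: "A / sin \<phi> \<le> sin \<phi> * g_fun d \<phi>"
    using t by (simp add: field_simps power2_eq_square)
  have "sin \<phi> \<le> A / N" using sin_x_le_x[of \<phi>] \<phi> by (simp add: I_plus_eq[OF valid] \<phi>_def)
  then have "N \<le> A / sin \<phi>" using N t by (simp add: field_simps)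
  with g have "2 * sin (theta d) / cos (theta d) * M \<le> sin \<phi> * g_fun d \<phi> - 9 / (4 * sin (theta d)) - 1"
    by (simp add: N_def)
  then have "cos (theta d) / (2 * sin (theta d)) * (2 * sin (theta d) / cos (theta d) * M)
    \<le> cos (theta d) / (2 * sin (theta d)) * (sin \<phi> * g_fun d \<phi> - 9 / (4 * sin (theta d)) - 1)"
    using sin_theta_pos cos_theta_pos by (intro mult_left_mono) auto
  then have "M \<le> mu_G d \<phi>"
    using mu_G_lower[OF \<phi>] sin_theta_pos cos_theta_pos by simp
  moreover have "0 \<le> tan (theta d - \<phi>) * mu_D d \<phi>" using t mu_D_pos[OF \<phi>] by simp
  ultimately show ?thesis using muL that[OF \<phi>] by simp
qed

section \<open>A solution with positive lift\<close>

lemma positive_lift_solution: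
  assumes endpoint: "endpoint_condition d"
    and lift_ne: "theta d \<le> twist d \<Longrightarrow> lift d (theta d - twist d) \<noteq> 0"
    and emp: "\<And>\<phi>. \<lbrakk>corr d = Empirical_Glauert; \<phi> \<in> I_plus d; lift d (\<phi> - twist d) \<le> 0\<rbrakk> \<Longrightarrow> 0 \<le> mu_G d \<phi>"
  shows "\<exists>\<phi>\<in>I_plus d. mu_L d \<phi> - tan (theta d - \<phi>) * mu_D d \<phi> = mu_G d \<phi> \<and> 0 < lift d (\<phi> - twist d)"
proof -
  define m where "m = phi_max d"
  define G where "G \<phi> = mu_L d \<phi> - tan (theta d - \<phi>) * mu_D d \<phi> - mu_G d \<phi>" for \<phi>
  have Ip: "I_plus d = {0<..m}" by (simp add: m_def I_plus_eq[OF valid])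
  have m: "m \<in> I_plus d" using phi_max_is_max(1)[OF valid] by (simp add: m_def)
  have muG: "0 \<le> mu_G d \<phi>" if "\<phi> \<in> I_plus d" "lift d (\<phi> - twist d) \<le> 0" for \<phi>
    using emp[OF _ that] mu_G_nonneg[OF _ that(1)] by (cases "corr d = Empirical_Glauert")
  have Gm: "0 \<le> G m" using endpoint by (simp add: endpoint_condition_def G_def m_def)
  have contG: "continuous_on (I_plus d) G"
    unfolding G_def
    by (intro continuous_on_diff continuous_on_mult continuous_on_mu_L continuous_on_mu_D
        continuous_on_mu_G continuous_on_tan_theta)
  have solve: "\<exists>\<phi>\<in>{b..m}. G \<phi> = 0" if "b \<in> I_plus d" "G b \<le> 0" for b
  proof -
    have "{b..m} \<subseteq> I_plus d" "b \<le> m" using that(1) unfolding Ip by auto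
    then show ?thesis
      using IVT'[of G b 0 m] Gm that(2) continuous_on_subset[OF contG] by auto
  qed
  \<comment> \<open>For twist below \<theta> the attack angle at \<open>m\<close> is positive.
    Otherwise m = \<theta> and the drag term vanishes, so negative lift would contradict the
    endpoint condition; zero lift is excluded by \<open>lift_ne\<close>.\<close>
  have lift_m: "0 < lift d (m - twist d)"
  proof (cases "twist d < theta d")
    case True
    then show ?thesis using valid by (auto simp: m_def phi_max_def valid_bem_def min_def)
  next
    case False
    show ?thesis
    proof (rule ccontr)
      assume neg: "\<not> 0 < lift d (m - twist d)"
      have "m = theta d" using False valid by (auto simp: m_def phi_max_def valid_bem_def)
      then have "lift d (m - twist d) < 0" using neg lift_ne False by simp
      moreover have "0 < solidity d / (4 * tip_loss d m)"
        using tip_loss_pos[OF m] valid by (simp add: valid_bem_def)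
      ultimately have "mu_L d m < 0" unfolding mu_L_def by (rule mult_pos_neg[rotated])
      moreover have "0 \<le> mu_G d m" using muG[OF m] neg by simp
      ultimately show False using Gm \<open>m = theta d\<close> by (simp add: G_def)
    qed
  qed
  show ?thesis
  proof (cases "\<forall>\<phi>\<in>I_plus d. 0 < lift d (\<phi> - twist d)")
    case True
    obtain b where b: "b \<in> I_plus d" "mu_L d b - tan (theta d - b) * mu_D d b \<le> mu_G d b"
      by (rule balance_negative_near_0)
    then have "G b \<le> 0" by (simp add: G_def)
    then obtain \<phi> where \<phi>: "\<phi> \<in> {b..m}" "G \<phi> = 0" using solve b by blast
    then have "\<phi> \<in> I_plus d" using b Ip by auto
    then show ?thesis using True \<phi> by (auto simp: G_def)
  next
    case False
    then obtain c where c: "c \<in> I_plus d" "lift d (c - twist d) \<le> 0" by (auto simp: not_less)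
    then have cm: "0 < c" "c \<le> m" unfolding Ip by auto
    then have sub: "{c..m} \<subseteq> I_plus d" unfolding Ip by auto
    \<comment> \<open>The maximum of this compact set is the last angle without positive
      lift.\<close>
    define S where "S = {\<phi> \<in> {c..m}. lift d (\<phi> - twist d) \<le> 0}"
    have "continuous_on {c..m} (\<lambda>\<phi>. lift d (\<phi> - twist d))"
      by (rule continuous_on_subset[OF continuous_on_lift sub])
    then have "closed S" unfolding S_def
      by (intro continuous_on_closed_Collect_le continuous_on_const) auto
    moreover have "{c..m} \<inter> S = S" by (auto simp: S_def)
    ultimately have "compact S" using compact_Int_closed[OF compact_Icc, of S c m] by simp
    moreover have "S \<noteq> {}" using c(2) cm(2) by (auto simp: S_def)
    ultimately obtain b where b: "b \<in> S" "\<forall>x\<in>S. x \<le> b" using compact_attains_sup by blast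
    then have bI: "b \<in> I_plus d" and lb: "lift d (b - twist d) \<le> 0"
      using sub by (auto simp: S_def)
    have "b \<noteq> m" using lift_m lb by auto
    with bI have "b < theta d" unfolding Ip m_def by (auto simp: phi_max_def min_def split: if_splits)
    have "0 \<le> solidity d / (4 * tip_loss d b)"
      using tip_loss_pos[OF bI] valid by (simp add: valid_bem_def)
    then have "mu_L d b \<le> 0" unfolding mu_L_def using lb by (rule mult_nonneg_nonpos)
    moreover have "0 < tan (theta d - b) * mu_D d b"
      using I_plus_trig(5)[OF bI \<open>b < theta d\<close>] mu_D_pos[OF bI] by simp
    \<comment> \<open>Strictness comes from the drag term, as b < \<theta>; it forces the root
      strictly to the right of \<open>b\<close>, hence outside \<open>S\<close>.\<close>
    ultimately have Gb: "G b < 0" using muG[OF bI lb] by (simp add: G_def)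
    then obtain \<phi> where \<phi>: "\<phi> \<in> {b..m}" "G \<phi> = 0" using solve[OF bI] by auto
    have "b < \<phi>" using \<phi> Gb by (cases "b = \<phi>") auto
    then have "\<phi> \<notin> S" using b by force
    then have "0 < lift d (\<phi> - twist d)" using \<phi> b by (auto simp: S_def)
    moreover have "\<phi> \<in> I_plus d" using \<phi>(1) bI unfolding Ip by auto
    ultimately show ?thesis using \<phi> by (auto simp: G_def)
  qed
qed

section \<open>The endpoint condition for decreasing g\<close>

text \<open>A limit of positive values from the right; it serves the case of attack angle 0 at
  \<theta>.\<close>

lemma lift_0_nonneg: "0 \<le> lift d 0"
proof (rule tendsto_lowerbound)
  have "continuous_on {0..max_attack d} (lift d)"
    using valid by (auto simp: valid_bem_def intro: continuous_on_subset)
  then show "(lift d \<longlongrightarrow> lift d 0) (at_right 0)"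
    using valid by (auto simp: valid_bem_def continuous_on_Icc_at_rightD)
  show "\<forall>\<^sub>F x in at_right 0. 0 \<le> lift d x"
    using valid by (auto simp: valid_bem_def eventually_at_right intro!: exI[of _ "max_attack d"] less_imp_le)
qed simp

lemma endpoint_conditionI:
  assumes \<phi>\<^sub>c: "\<phi>\<^sub>c \<in> I_plus d" "tau d \<phi>\<^sub>c = a_crit d"
    and anti: "antimono_on (I_plus d) (g_fun d)" and max: "phi_max d = theta d"
    and nonneg: "theta d < twist d \<Longrightarrow> 0 \<le> lift d (theta d - twist d)"
  shows "endpoint_condition d"
proof -
  have th: "theta d \<in> I_plus d" and "\<phi>\<^sub>c \<le> theta d"
    using phi_max_is_max[OF valid] \<phi>\<^sub>c max by auto
  then have "g_fun d (theta d) \<le> g_fun d \<phi>\<^sub>c"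
    using anti \<phi>\<^sub>c by (auto simp: monotone_on_def)
  also have "\<dots> = thrust d \<phi>\<^sub>c (a_crit d)" using tau_root[OF \<phi>\<^sub>c(1)] \<phi>\<^sub>c(2) by simp
  \<comment> \<open>At \<open>a_crit\<close> the correction vanishes, so the value does not depend
    on the angle and can be carried from \<open>\<phi>\<^sub>c\<close> to \<theta>.\<close>
  also have "\<dots> = thrust d (theta d) (a_crit d)" by (simp add: thrust_le_a_crit)
  finally have "tau d (theta d) \<le> a_crit d"
    using tau_root[OF th] thrust_strict_mono[OF th, of "a_crit d" "tau d (theta d)"] by linarith
  then have "mu_G d (theta d) = 0" by (simp add: mu_G_def psi_plus_eq_0)
  \<comment> \<open>Since tan 0 = 0 and \<open>mu_G\<close> vanishes at \<theta>, the endpoint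
    condition reduces to nonnegative lift there.\<close>
  moreover have "0 \<le> lift d (theta d - twist d)"
  proof (cases "theta d" "twist d" rule: linorder_cases)
    case greater
    moreover have "theta d \<le> max_attack d + twist d" using max by (simp add: phi_max_def)
    ultimately show ?thesis using valid by (auto simp: valid_bem_def intro: less_imp_le)
  qed (use nonneg lift_0_nonneg in auto)
  then have "0 \<le> mu_L d (theta d)"
    using tip_loss_pos[OF th] valid by (simp add: mu_L_def valid_bem_def)
  ultimately show ?thesis by (simp add: endpoint_condition_def max)
qed

end

theorem corollary3p8:
  fixes d :: bem
  assumes "valid_bem d"
  shows
    "(endpoint_condition d
       \<and> (theta d \<le> twist d \<longrightarrow> lift d (theta d - twist d) \<noteq> 0)
       \<and> (corr d = Empirical_Glauert \<longrightarrow>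
            (\<forall>\<phi>\<in>I_plus d. lift d (\<phi> - twist d) \<le> 0 \<longrightarrow> 0 \<le> mu_G d \<phi>))
      \<longrightarrow> (\<exists>\<phi>\<in>I_plus d. mu_L d \<phi> - tan (theta d - \<phi>) * mu_D d \<phi> = mu_G d \<phi>
                        \<and> 0 < lift d (\<phi> - twist d)))
     \<and> (\<forall>\<phi>\<^sub>c\<in>I_plus d.
          antimono_on (I_plus d) (g_fun d) \<and> phi_max d = theta d
          \<and> tau d \<phi>\<^sub>c = a_crit d \<and> \<phi>\<^sub>c < theta d
          \<and> (theta d < twist d \<longrightarrow> 0 \<le> lift d (theta d - twist d))
        \<longrightarrow> endpoint_condition d)"
  using positive_lift_solution[OF assms] endpoint_conditionI[OF assms] by blast

end
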